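(* Let $c>0$ be an even integer and $d$ an odd integer coprime to $c$. Let $n\ge1$ be odd and let $c_0,c_1,\dots,c_n$ be integers with $c_1,\dots,c_n$ non-zero such that $\frac{d}{c}=\llbracket 2c_0;2c_1,\dots,2c_n\rrbracket$. Then $$S(d,c)+S_4(d,c)=2\sum_{\substack{k=1\\ k\ \mathrm{odd}}}^{c-1}(-1)^{\lfloor dk/c\rfloor}=-2\,(c_1+c_3+\dots+c_n).$$
   Context: For coprime integers $d,c$ with $c>0$ the Hardy sums are $$S(d,c)=\sum_{k=1}^{c-1}(-1)^{k+1+\lfloor dk/c\rfloor},\qquad S_4(d,c)=\sum_{k=1}^{c-1}(-1)^{\lfloor dk/c\rfloor}.$$ Negative continued fractions (partial quotients may be negative): $$\llbracket b_0;b_1,\dots,b_n\rrbracket=b_0-\cfrac{1}{b_1-\cfrac{1}{\cdots-\cfrac{1}{b_n}}}.$$ *)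

theory Defs
  imports Complex_Main
begin

text \<open>
  The exponents in the Hardy sums are arbitrary integers (negative for \<open>d < 0\<close>), hence the integer
  power \<open>powi\<close> and values in the reals. The sums are meant for coprime \<open>d\<close>, \<open>c\<close> with \<open>c > 0\<close>.
\<close>

definition hardy_S :: "int \<Rightarrow> int \<Rightarrow> real" where
  "hardy_S d c = (\<Sum>k = 1..c - 1. (-1) powi (k + 1 + \<lfloor>real_of_int (d * k) / real_of_int c\<rfloor>))"

definition hardy_S4 :: "int \<Rightarrow> int \<Rightarrow> real" where
  "hardy_S4 d c = (\<Sum>k = 1..c - 1. (-1) powi \<lfloor>real_of_int (d * k) / real_of_int c\<rfloor>)"

text \<open>
  The negative continued fraction of a nonempty list of partial quotients; the value for the empty
  list is a dummy. Where a tail evaluates to \<open>0\<close>, the convention \<open>1 / 0 = 0\<close> applies; this cannot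
  happen if all partial quotients after the first have absolute value at least \<open>2\<close>, since then
  every proper tail has absolute value greater than \<open>1\<close>.
\<close>

fun neg_cfrac :: "int list \<Rightarrow> real" where
  "neg_cfrac [] = 0"
| "neg_cfrac [b] = real_of_int b"
| "neg_cfrac (b # b' # bs) = real_of_int b - 1 / neg_cfrac (b' # bs)"

end

theory Submission
  imports Defs
begin

text \<open>
  Write \<open>T(d/c)\<close> for the sum of the signs \<open>(-1)^\<lfloor>dk/c\<rfloor>\<close> over odd \<open>k < c\<close>. It is odd in \<open>d\<close> and
  has period \<open>2\<close> in \<open>d/c\<close>. For \<open>d > 0\<close>, grouping the \<open>k\<close> by the value \<open>j\<close> of the floor expresses it
  as the alternating sum over \<open>j < d\<close> of the differences of \<open>N\<^sub>j = \<lfloor>(jc + d) / 2d\<rfloor>\<close>. Replacing \<open>c\<close> by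
  \<open>c + 2md\<close> adds \<open>mj\<close> to \<open>N\<^sub>j\<close>, hence \<open>m\<close> to the sum, as \<open>d\<close> is odd. Prepending two partial quotients
  \<open>2a, 2b\<close> to a continued fraction \<open>p/q\<close> gives \<open>2a - p/(2bp - q)\<close>, and so changes \<open>T\<close> by \<open>-b\<close>.
\<close>

section \<open>Floors of integer quotients\<close>

lemma uminus_div_eq_if_not_dvd:
  fixes a b :: int
  assumes "b \<noteq> 0" "\<not> b dvd a"
  shows "- a div b = - (a div b) - 1"
  using assms zdiv_zminus1_eq_if[of b a] by (simp add: dvd_eq_mod_eq_0)

lemma int_div_less_iff_less_mult:
  fixes a b i :: int
  assumes "b > 0"
  shows "a div b < i \<longleftrightarrow> a < i * b"
proof -
  have "a div b < i \<longleftrightarrow> real_of_int a / real_of_int b < real_of_int i"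
    by (simp add: floor_less_iff flip: floor_divide_of_int_eq[where ?'a = real])
  also have "\<dots> \<longleftrightarrow> real_of_int a < real_of_int (i * b)"
    using assms by (simp add: pos_divide_less_eq)
  finally show ?thesis unfolding of_int_less_iff .
qed

section \<open>Signs by parity and symmetries of the sum over odd multiples\<close>

definition parity_sign :: "int \<Rightarrow> int" where
  "parity_sign m = (if even m then 1 else - 1)"

lemma parity_sign_uminus_diff_1: "parity_sign (- m - 1) = - parity_sign m"
  by (simp add: parity_sign_def)

lemma powi_minus_one_eq_parity_sign: "(- 1 :: real) powi m = of_int (parity_sign m)"
  by (simp add: parity_sign_def power_int_minus_left)

text \<open>
  The factor \<open>sgn c\<close> extends the sum to negative denominators so that it depends on \<open>d/c\<close> only;
  at \<open>d/c = 1/0\<close> it is \<open>0\<close>.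
\<close>

definition odd_hardy_sum :: "int \<Rightarrow> int \<Rightarrow> int" where
  "odd_hardy_sum d c = sgn c * (\<Sum>i = 1..\<bar>c\<bar> div 2. parity_sign (d * (2 * i - 1) div \<bar>c\<bar>))"

lemma odd_hardy_sum_uminus_right: "odd_hardy_sum d (- c) = - odd_hardy_sum d c"
  by (simp add: odd_hardy_sum_def)

text \<open>An even \<open>c\<close> never divides the odd number \<open>d * (2 * i - 1)\<close>.
  The quotient is thus not an integer, and negating it turns its floor \<open>m\<close> into
  \<open>- m - 1\<close>, of opposite parity.\<close>

lemma odd_hardy_sum_uminus_left:
  assumes "odd d" "even c"
  shows "odd_hardy_sum (- d) c = - odd_hardy_sum d c"
proof (cases "c = 0")
  case False
  have "parity_sign (- d * (2 * i - 1) div \<bar>c\<bar>) = - parity_sign (d * (2 * i - 1) div \<bar>c\<bar>)" for i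
  proof -
    have "odd (d * (2 * i - 1))" using assms by simp
    then have "\<not> \<bar>c\<bar> dvd d * (2 * i - 1)" using assms by (meson abs_dvd_iff dvd_trans dvd_abs_iff)
    then have "- (d * (2 * i - 1)) div \<bar>c\<bar> = - (d * (2 * i - 1) div \<bar>c\<bar>) - 1"
      using False by (intro uminus_div_eq_if_not_dvd) auto
    then show ?thesis by (simp add: parity_sign_uminus_diff_1)
  qed
  then show ?thesis by (simp add: odd_hardy_sum_def sum_negf)
qed (simp add: odd_hardy_sum_def)

lemma odd_hardy_sum_add_period: "odd_hardy_sum (d + 2 * m * c) c = odd_hardy_sum d c"
proof (cases "c = 0")
  case False
  have "parity_sign ((d + 2 * m * c) * (2 * i - 1) div \<bar>c\<bar>) = parity_sign (d * (2 * i - 1) div \<bar>c\<bar>)"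
    for i
  proof -
    \<comment> \<open>The factor \<open>sgn c\<close> comes from writing \<open>c\<close> as
      \<open>sgn c * \<bar>c\<bar>\<close>; the floor then shifts by an even number.\<close>
    have "(d + 2 * m * c) * (2 * i - 1)
        = d * (2 * i - 1) + (2 * (m * sgn c * (2 * i - 1))) * \<bar>c\<bar>"
      by (simp add: abs_if sgn_if algebra_simps)
    then have "(d + 2 * m * c) * (2 * i - 1) div \<bar>c\<bar>
        = 2 * (m * sgn c * (2 * i - 1)) + d * (2 * i - 1) div \<bar>c\<bar>"
      using False by (metis abs_eq_0 div_mult_self1)
    then show ?thesis by (simp add: parity_sign_def)
  qed
  then show ?thesis by (simp add: odd_hardy_sum_def)
qed (simp add: odd_hardy_sum_def)

section \<open>Grouping by the value of the floor\<close>

text \<open>For odd \<open>d > 0\<close> and even \<open>c > 0\<close> this is the number of odd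
  \<open>k \<ge> 1\<close> with \<open>d * k < j * c\<close>, that is, with
  \<open>d * k div c < j\<close>. The closed form also makes sense for
  \<open>c \<le> 0\<close>.\<close>

definition level_count :: "int \<Rightarrow> int \<Rightarrow> nat \<Rightarrow> int" where
  "level_count d c j = (int j * c + d) div (2 * d)"

lemma less_level_count_iff:
  assumes "d > 0" "odd d" "even c"
  shows "level_count d c j < i \<longleftrightarrow> int j * c \<le> d * (2 * i - 1)"
proof -
  have "level_count d c j < i \<longleftrightarrow> int j * c + d < i * (2 * d)"
    using assms unfolding level_count_def by (intro int_div_less_iff_less_mult) simp
  also have "\<dots> \<longleftrightarrow> int j * c < d * (2 * i - 1)"
    by (simp add: algebra_simps)
  \<comment> \<open>Equality cannot occur: the left side is even, the right side odd.\<close>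
  also have "\<dots> \<longleftrightarrow> int j * c \<le> d * (2 * i - 1)"
  proof -
    have "odd (d * (2 * i - 1))" "even (int j * c)" using assms by simp_all
    then have "int j * c \<noteq> d * (2 * i - 1)" by metis
    then show ?thesis by linarith
  qed
  finally show ?thesis .
qed

lemma level_count_mono:
  assumes "d > 0" "c \<ge> 0"
  shows "level_count d c j \<le> level_count d c (Suc j)"
  unfolding level_count_def using assms by (intro zdiv_mono1) (simp_all add: algebra_simps)

text \<open>The indices above \<open>level_count d c j\<close> and up to
  \<open>level_count d c (Suc j)\<close> are those where the floor equals \<open>j\<close>, so each
  block has a constant sign.\<close>

lemma sum_parity_sign_upto_level_count:
  assumes "d > 0" "odd d" "even c" "c > 0"
  shows "(\<Sum>i = 1..level_count d c m. parity_sign (d * (2 * i - 1) div c))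
    = (\<Sum>j<m. parity_sign (int j) * (level_count d c (Suc j) - level_count d c j))"
proof (induction m)
  case 0
  then show ?case using assms by (simp add: level_count_def)
next
  case (Suc m)
  let ?N = "level_count d c" and ?f = "\<lambda>i. parity_sign (d * (2 * i - 1) div c)"
  have le: "?N m \<le> ?N (Suc m)" using assms by (intro level_count_mono) auto
  \<comment> \<open>Nonnegativity keeps indices below 1 out of the new block.\<close>
  have "0 \<le> ?N m" using assms by (simp add: level_count_def pos_imp_zdiv_nonneg_iff)
  then have split: "{1..?N (Suc m)} = {1..?N m} \<union> {?N m<..?N (Suc m)}" using le by auto
  have "d * (2 * i - 1) div c = int m" if "i \<in> {?N m<..?N (Suc m)}" for i
  proof -
    have "int m * c \<le> d * (2 * i - 1)" "\<not> int (Suc m) * c \<le> d * (2 * i - 1)"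
      using that assms less_level_count_iff by (metis greaterThanAtMost_iff linorder_not_less)+
    then show ?thesis using \<open>c > 0\<close>
      by (intro int_div_pos_eq[where r = "d * (2 * i - 1) - c * int m"]) (auto simp: algebra_simps)
  qed
  then have "sum ?f {?N m<..?N (Suc m)} = parity_sign (int m) * (?N (Suc m) - ?N m)"
    using le by (simp add: mult.commute)
  moreover have "sum ?f {1..?N (Suc m)} = sum ?f {1..?N m} + sum ?f {?N m<..?N (Suc m)}"
    unfolding split by (rule sum.union_disjoint) auto
  ultimately show ?case using Suc.IH by simp
qed

text \<open>The odd number \<open>j * c + d\<close> is not divisible by \<open>2 * d\<close>, so
  negating it costs 1 in the floor; passing from \<open>- j * c - d\<close> to
  \<open>- j * c + d\<close> adds \<open>2 * d\<close> and restores that 1.\<close>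

lemma level_count_uminus:
  assumes "d > 0" "odd d" "even c"
  shows "level_count d (- c) j = - level_count d c j"
proof -
  let ?x = "int j * c + d"
  have "\<not> 2 * d dvd ?x" using assms by (metis dvd_add_right_iff dvd_mult dvd_mult_left)
  then have "- ?x div (2 * d) = - (?x div (2 * d)) - 1"
    using assms by (intro uminus_div_eq_if_not_dvd) auto
  moreover have "int j * (- c) + d = - ?x + 1 * (2 * d)" by simp
  then have "(int j * (- c) + d) div (2 * d) = 1 + - ?x div (2 * d)"
    using assms by (metis div_mult_self1 less_irrefl mult_eq_0_iff zero_neq_numeral)
  ultimately show ?thesis unfolding level_count_def by simp
qed

text \<open>The levels below \<open>d\<close> exhaust the index range, since
  \<open>level_count d c d\<close> is \<open>(c + 1) div 2 = c div 2\<close>. Negative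
  \<open>c\<close> must be covered because \<open>c + 2 * m * d\<close> can have any sign; there
  both sides are odd in \<open>c\<close>.\<close>

lemma odd_hardy_sum_eq_level_count:
  assumes "d > 0" "odd d" "even c"
  shows "odd_hardy_sum d c
    = (\<Sum>j<nat d. parity_sign (int j) * (level_count d c (Suc j) - level_count d c j))"
    (is "_ = ?R c")
proof -
  have pos: "odd_hardy_sum d c = ?R c" if "even c" "c > 0" for c
  proof -
    have "level_count d c (nat d) = d * (c + 1) div (d * 2)"
      using assms by (simp add: level_count_def algebra_simps)
    also have "\<dots> = c div 2" using assms that by (subst div_mult_mult1) auto
    finally show ?thesis
      using sum_parity_sign_upto_level_count[OF assms(1,2) that, of "nat d"] that
      by (simp add: odd_hardy_sum_def)
  qed
  consider "c > 0" | "c = 0" | "- c > 0" by linarith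
  then show ?thesis
  proof cases
    case 1
    then show ?thesis using pos assms by blast
  next
    case 2
    then show ?thesis by (simp add: odd_hardy_sum_def level_count_def)
  next
    case 3
    then have "odd_hardy_sum d (- c) = ?R (- c)" using pos assms by simp
    moreover have "?R (- c) = - ?R c"
      by (simp add: level_count_uminus[OF assms] sum_negf[symmetric] algebra_simps)
    ultimately show ?thesis by (simp add: odd_hardy_sum_uminus_right)
  qed
qed

lemma sum_parity_sign_lessThan: "(\<Sum>j<n. parity_sign (int j)) = (if even n then 0 else 1)"
  by (induction n) (auto simp: parity_sign_def)

lemma odd_hardy_sum_add_right_pos:
  assumes "d > 0" "odd d" "even c"
  shows "odd_hardy_sum d (c + 2 * m * d) = odd_hardy_sum d c + m"
proof -
  have "level_count d (c + 2 * m * d) j = int j * m + level_count d c j" for j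
  proof -
    have "int j * (c + 2 * m * d) + d = (int j * c + d) + (int j * m) * (2 * d)"
      by (simp add: algebra_simps)
    then show ?thesis
      unfolding level_count_def using \<open>d > 0\<close>
      by (metis div_mult_self1 less_irrefl mult_eq_0_iff zero_neq_numeral)
  qed
  then have "odd_hardy_sum d (c + 2 * m * d)
      = (\<Sum>j<nat d. parity_sign (int j) * (level_count d c (Suc j) - level_count d c j)
           + parity_sign (int j) * m)"
    using assms by (simp add: odd_hardy_sum_eq_level_count algebra_simps)
  also have "\<dots> = odd_hardy_sum d c + (\<Sum>j<nat d. parity_sign (int j)) * m"
    using assms by (simp add: odd_hardy_sum_eq_level_count sum.distrib sum_distrib_right)
  also have "(\<Sum>j<nat d. parity_sign (int j)) = 1"
    using assms by (simp add: sum_parity_sign_lessThan even_nat_iff)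
  finally show ?thesis by simp
qed

lemma odd_hardy_sum_add_right:
  assumes "odd d" "even c"
  shows "odd_hardy_sum d (c + 2 * m * d) = odd_hardy_sum d c + m"
proof (cases "d > 0")
  case True
  then show ?thesis using assms odd_hardy_sum_add_right_pos by blast
next
  case False
  with assms have "- d > 0" by (cases "d = 0") auto
  \<comment> \<open>Negating both \<open>m\<close> and \<open>d\<close> leaves the shift
    \<open>2 * m * d\<close> unchanged.\<close>
  then have "odd_hardy_sum (- d) (c + 2 * (- m) * (- d)) = odd_hardy_sum (- d) c + (- m)"
    using assms by (intro odd_hardy_sum_add_right_pos) auto
  then show ?thesis using assms by (simp add: odd_hardy_sum_uminus_left)
qed

section \<open>Prepending two partial quotients\<close>

lemma odd_hardy_sum_cfrac_step:
  assumes "odd p" "even q"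
  shows "odd_hardy_sum (2 * a * (2 * b * p - q) - p) (2 * b * p - q) = odd_hardy_sum p q - b"
proof -
  let ?r = "2 * b * p - q"
  have "odd_hardy_sum (2 * a * ?r - p) ?r = odd_hardy_sum (- p) ?r"
    using odd_hardy_sum_add_period[of "- p" a ?r] by simp
  also have "\<dots> = - odd_hardy_sum p ?r"
    using assms by (simp add: odd_hardy_sum_uminus_left)
  also have "odd_hardy_sum p ?r = odd_hardy_sum p (- q) + b"
    using odd_hardy_sum_add_right[of p "- q" b] assms by simp
  finally show ?thesis by (simp add: odd_hardy_sum_uminus_right)
qed

text \<open>The map from \<open>(p, q)\<close> to the new pair is linear of determinant 1.
  Reducedness later identifies the computed fraction with \<open>d / c\<close> up to a common
  sign.\<close>

lemma coprime_cfrac_step: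
  fixes p q :: int
  assumes "coprime p q"
  shows "coprime (2 * a * (2 * b * p - q) - p) (2 * b * p - q)"
proof (rule coprimeI)
  fix e assume e: "e dvd 2 * a * (2 * b * p - q) - p" "e dvd 2 * b * p - q"
  then have "e dvd p" by (metis dvd_diff_right_iff dvd_mult dvd_diff_commute)
  moreover from this e(2) have "e dvd q" by (metis dvd_diff_right_iff dvd_mult)
  ultimately show "is_unit e" using assms coprime_common_divisor by blast
qed

text \<open>Each tail has a reciprocal smaller than 1 in absolute value, which cannot bring a
  quotient of size at least 2 down to 1. This rules out vanishing denominators.\<close>

lemma abs_neg_cfrac_gt_1:
  assumes "bs \<noteq> []" "\<And>b. b \<in> set bs \<Longrightarrow> \<bar>b\<bar> \<ge> 2"
  shows "\<bar>neg_cfrac bs\<bar> > 1"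
  using assms
proof (induction bs rule: neg_cfrac.induct)
  case (2 b)
  then have "\<bar>b\<bar> \<ge> 2" by simp
  then show ?case by simp
next
  case (3 b b' bs)
  then have "\<bar>neg_cfrac (b' # bs)\<bar> > 1" by simp
  then have "\<bar>1 / neg_cfrac (b' # bs)\<bar> < 1" by simp
  moreover have "\<bar>b\<bar> \<ge> 2" using 3 by simp
  then have "\<bar>real_of_int b\<bar> \<ge> 2" by linarith
  ultimately show ?case unfolding neg_cfrac.simps by linarith
qed simp

lemma neg_cfrac_Cons_Cons_quotient:
  assumes "bs \<noteq> []" "neg_cfrac bs = of_int p / of_int q" "b * p - q \<noteq> 0" "p \<noteq> 0"
  shows "neg_cfrac (a # b # bs) = of_int (a * (b * p - q) - p) / of_int (b * p - q)"
proof -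
  obtain b' bs' where bs: "bs = b' # bs'" using assms(1) by (cases bs) auto
  let ?r = "b * p - q"
  have "neg_cfrac (b # bs) = of_int ?r / of_int p"
    using assms(4) by (simp add: bs assms(2)[unfolded bs] field_simps)
  then have "neg_cfrac (a # b # bs) = of_int a - of_int p / of_int ?r"
    by simp
  also have "\<dots> = of_int (a * ?r - p) / of_int ?r"
    unfolding of_int_diff[of "a * ?r"] of_int_mult[of a ?r]
    using assms(3) by (simp add: diff_divide_distrib del: of_int_diff of_int_mult)
  finally show ?thesis .
qed

text \<open>The induction strips two quotients at a time, so \<open>cs\<close> is generalized to
  allow the shift by 2. Only the second quotient of each pair affects the sum, whence the odd
  indices.\<close>

lemma neg_cfrac_even_quotients:
  assumes "\<And>i. 1 \<le> i \<Longrightarrow> i < 2 * m + 2 \<Longrightarrow> cs i \<noteq> 0"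
  shows "\<exists>p q. odd p \<and> even q \<and> coprime p q \<and> q \<noteq> 0
    \<and> neg_cfrac (map (\<lambda>i. 2 * cs i) [0..<2 * m + 2]) = of_int p / of_int q
    \<and> odd_hardy_sum p q = - (\<Sum>j\<le>m. cs (2 * j + 1))"
  using assms
proof (induction m arbitrary: cs)
  case 0
  have nz: "cs 1 \<noteq> 0" using 0 by simp
  \<comment> \<open>The base case is the same step applied to the formal fraction 1/0, whose sum is
    0.\<close>
  let ?p = "2 * cs 0 * (2 * cs 1 * 1 - 0) - 1" and ?q = "2 * cs 1 * 1 - 0"
  have "coprime ?p ?q" by (rule coprime_cfrac_step) simp
  moreover have "odd_hardy_sum ?p ?q = odd_hardy_sum 1 0 - cs 1"
    by (rule odd_hardy_sum_cfrac_step) simp_all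
  moreover have "neg_cfrac (map (\<lambda>i. 2 * cs i) [0..<2 * 0 + 2]) = of_int ?p / of_int ?q"
    using nz by (simp add: upt_rec field_simps)
  moreover have "odd ?p" "even ?q" "?q \<noteq> 0" using nz by simp_all
  ultimately show ?case by (intro exI[of _ ?p] exI[of _ ?q]) (simp add: odd_hardy_sum_def)
next
  case (Suc m)
  let ?bs = "map (\<lambda>i. 2 * cs (i + 2)) [0..<2 * m + 2]"
  have "cs (i + 2) \<noteq> 0" if "i < 2 * m + 2" for i using Suc.prems that by simp
  then have "\<exists>p q. odd p \<and> even q \<and> coprime p q \<and> q \<noteq> 0 \<and> neg_cfrac ?bs = of_int p / of_int q
    \<and> odd_hardy_sum p q = - (\<Sum>j\<le>m. cs (2 * j + 1 + 2))"
    by (intro Suc.IH) simp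
  then obtain p q where pq: "odd p" "even q" "coprime p q" "q \<noteq> 0"
    and val: "neg_cfrac ?bs = of_int p / of_int q"
    and sum: "odd_hardy_sum p q = - (\<Sum>j\<le>m. cs (2 * j + 1 + 2))" by blast
  have "p \<noteq> 0" using pq by auto
  have nz: "cs 1 \<noteq> 0" using Suc.prems by simp
  let ?r = "2 * cs 1 * p - q"
  let ?p = "2 * cs 0 * ?r - p"
  have "\<bar>neg_cfrac ?bs\<bar> > 1"
  proof (rule abs_neg_cfrac_gt_1)
    fix b assume "b \<in> set ?bs"
    then obtain i where "i < 2 * m + 2" "b = 2 * cs (i + 2)"
      by (auto simp del: upt_Suc)
    moreover from this have "cs (i + 2) \<noteq> 0" using Suc.prems by simp
    ultimately show "\<bar>b\<bar> \<ge> 2" by simp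
  qed simp
  then have "1 < \<bar>real_of_int p / real_of_int q\<bar>" unfolding val .
  \<comment> \<open>As \<open>\<bar>2 * cs 1 * p\<bar> \<ge> \<bar>p\<bar> > \<bar>q\<bar>\<close>,
    the new denominator \<open>?r\<close> is nonzero.\<close>
  then have "\<bar>q\<bar> < \<bar>p\<bar>" using pq by (simp add: field_simps flip: of_int_abs)
  moreover have "1 * \<bar>p\<bar> \<le> \<bar>2 * cs 1\<bar> * \<bar>p\<bar>" using nz by (intro mult_right_mono) auto
  ultimately have r: "?r \<noteq> 0" by (auto simp: abs_mult)
  have "[0..<2 * Suc m + 2] = 0 # 1 # [2..<2 * m + 2 + 2]"
    by (simp add: upt_conv_Cons numeral_2_eq_2 del: upt_Suc)
  then have "[0..<2 * Suc m + 2] = 0 # 1 # map (\<lambda>i. i + 2) [0..<2 * m + 2]"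
    unfolding map_add_upt .
  then have "map (\<lambda>i. 2 * cs i) [0..<2 * Suc m + 2] = 2 * cs 0 # 2 * cs 1 # ?bs"
    by (simp add: comp_def del: upt_Suc)
  moreover have "neg_cfrac (2 * cs 0 # 2 * cs 1 # ?bs) = of_int ?p / of_int ?r"
    using val r \<open>p \<noteq> 0\<close> by (intro neg_cfrac_Cons_Cons_quotient) auto
  moreover have "coprime ?p ?r" using pq by (intro coprime_cfrac_step)
  moreover have "odd ?p" "even ?r" using pq by simp_all
  moreover have "odd_hardy_sum ?p ?r = - (\<Sum>j\<le>Suc m. cs (2 * j + 1))"
    unfolding odd_hardy_sum_cfrac_step[OF pq(1,2)] sum
    by (simp only: sum.atMost_Suc_shift) (simp add: algebra_simps)
  ultimately show ?case using r by metis
qed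

section \<open>Return to the Hardy sums\<close>

lemma sum_odd_powi_floor_eq_odd_hardy_sum:
  assumes "c > 0" "even c"
  shows "(\<Sum>k \<in> {k \<in> {1..c - 1}. odd k}. (- 1 :: real) powi \<lfloor>real_of_int (d * k) / real_of_int c\<rfloor>)
    = of_int (odd_hardy_sum d c)"
proof -
  have "(\<Sum>k \<in> {k \<in> {1..c - 1}. odd k}. parity_sign (d * k div c))
      = (\<Sum>i = 1..c div 2. parity_sign (d * (2 * i - 1) div c))"
    using assms
    by (intro sum.reindex_bij_witness[of _ "\<lambda>i. 2 * i - 1" "\<lambda>k. (k + 1) div 2"])
      (auto simp: add.commute elim!: oddE evenE)
  then show ?thesis
    using assms
    by (simp add: odd_hardy_sum_def powi_minus_one_eq_parity_sign floor_divide_of_int_eq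
          flip: of_int_mult of_int_sum)
qed

text \<open>The extra sign \<open>(-1)^(k + 1)\<close> in \<open>hardy_S\<close> makes the terms
  with even \<open>k\<close> cancel and those with odd \<open>k\<close> double.\<close>

lemma hardy_S_plus_hardy_S4:
  "hardy_S d c + hardy_S4 d c
    = 2 * (\<Sum>k \<in> {k \<in> {1..c - 1}. odd k}. (-1) powi \<lfloor>real_of_int (d * k) / real_of_int c\<rfloor>)"
proof -
  let ?f = "\<lambda>k. \<lfloor>real_of_int (d * k) / real_of_int c\<rfloor>"
  have "hardy_S d c + hardy_S4 d c = (\<Sum>k = 1..c - 1. if odd k then 2 * (-1) powi ?f k else 0)"
    unfolding hardy_S_def hardy_S4_def sum.distrib[symmetric]
    by (intro sum.cong) (auto simp: powi_minus_one_eq_parity_sign parity_sign_def)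
  also have "\<dots> = (\<Sum>k \<in> {k \<in> {1..c - 1}. odd k}. 2 * (-1) powi ?f k)"
    by (simp only: sum.inter_filter finite_atLeastAtMost_int)
  finally show ?thesis by (simp add: sum_distrib_left)
qed

theorem corollary1p3:
  fixes c d :: int and n :: nat and cs :: "nat \<Rightarrow> int"
  assumes "c > 0" and "even c" and "odd d" and "coprime d c"
    and "n \<ge> 1" and "odd n"
    and "\<And>i. 1 \<le> i \<Longrightarrow> i \<le> n \<Longrightarrow> cs i \<noteq> 0"
    and "real_of_int d / real_of_int c = neg_cfrac (map (\<lambda>i. 2 * cs i) [0..<Suc n])"
  shows "hardy_S d c + hardy_S4 d c
           = 2 * (\<Sum>k \<in> {k \<in> {1..c - 1}. odd k}. (-1) powi \<lfloor>real_of_int (d * k) / real_of_int c\<rfloor>)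
       \<and> 2 * (\<Sum>k \<in> {k \<in> {1..c - 1}. odd k}. (-1) powi \<lfloor>real_of_int (d * k) / real_of_int c\<rfloor>)
           = - 2 * real_of_int (\<Sum>i \<in> {i \<in> {1..n}. odd i}. cs i)"
proof -
  obtain m where n: "n = 2 * m + 1" using \<open>odd n\<close> oddE by blast
  have "cs i \<noteq> 0" if "1 \<le> i" "i < 2 * m + 2" for i using assms(7) that n by simp
  then obtain p q where pq: "odd p" "even q" "coprime p q" "q \<noteq> 0"
    and val: "neg_cfrac (map (\<lambda>i. 2 * cs i) [0..<2 * m + 2]) = of_int p / of_int q"
    and sum: "odd_hardy_sum p q = - (\<Sum>j\<le>m. cs (2 * j + 1))"
    using neg_cfrac_even_quotients[of m cs] by blast
  have "real_of_int d / real_of_int c = of_int p / of_int q"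
    using assms(8) val n by simp
  then have "real_of_int (d * q) = real_of_int (p * c)"
    using \<open>c > 0\<close> \<open>q \<noteq> 0\<close> by (simp add: field_simps)
  then have cross: "d * q = p * c" by linarith
  then have "\<bar>d\<bar> * \<bar>q\<bar> = \<bar>p\<bar> * \<bar>c\<bar>" by (metis abs_mult)
  then have "\<bar>d\<bar> = \<bar>p\<bar>" "\<bar>q\<bar> = \<bar>c\<bar>"
    using coprime_crossproduct_int[of d c p q] \<open>coprime d c\<close> pq(3) by auto
  \<comment> \<open>The denominator \<open>q\<close> may be negative, so the reduced fractions agree
    only up to a common sign. The sum is odd in each argument, hence unaffected by it.\<close>
  then have "d = p \<and> c = q \<or> d = - p \<and> c = - q"
    using cross \<open>q \<noteq> 0\<close> pq(1) by (auto simp: abs_eq_iff)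
  then have T: "odd_hardy_sum d c = - (\<Sum>j\<le>m. cs (2 * j + 1))"
    using sum pq by (auto simp: odd_hardy_sum_uminus_left odd_hardy_sum_uminus_right)
  have "(\<Sum>i \<in> {i \<in> {1..n}. odd i}. cs i) = (\<Sum>j\<le>m. cs (2 * j + 1))"
    by (intro sum.reindex_bij_witness[of _ "\<lambda>j. 2 * j + 1" "\<lambda>i. i div 2"]) (auto simp: n elim!: oddE)
  with T have "of_int (odd_hardy_sum d c) = - real_of_int (\<Sum>i \<in> {i \<in> {1..n}. odd i}. cs i)"
    by simp
  then show ?thesis
    using hardy_S_plus_hardy_S4[of d c]
      sum_odd_powi_floor_eq_odd_hardy_sum[OF \<open>c > 0\<close> \<open>even c\<close>, of d] by simp
qed

end
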